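(* Let $\Gamma$ be an infinite finitely generated group, $\Gamma\rhd\Gamma_1\rhd\Gamma_2\rhd\cdots$ a nested sequence of finite index normal subgroups with $\bigcap_n\Gamma_n=\{1\}$, $S$ a finite generating set of $\Gamma$, and $\mathcal{G}=\{G_n\}$ with $G_n$ the Cayley graph of $\Gamma/\Gamma_n$ with respect to $S$. Then for every $k\ge1$, $$\frac{d(\Gamma_k)}{|\Gamma:\Gamma_k|}+1\ge c(\mathcal{G}),$$ where $d(\Gamma_k)$ is the minimal number of generators of $\Gamma_k$.
   Context: The Cayley graph of $\Gamma/\Gamma_n$ w.r.t. $S$ has vertex set $\Gamma/\Gamma_n$, with $x\ne y$ adjacent iff $y=sx$ or $x=sy$ for some $s\in S$. A graph sequence is a sequence $\{G_n\}$ of finite simple graphs with uniformly bounded degrees and $|V(G_n)|\to\infty$. For graph sequences with $V(H_n)=V(G_n)$, $\mathcal{H}\prec\mathcal{G}$ means there is an integer $L>0$ with $d_{G_n}(x,y)\le L\,d_{H_n}(x,y)$ for all $n,x,y$ (shortest path metrics); $\mathcal{G}\simeq\mathcal{H}$ means $\mathcal{H}\prec\mathcal{G}$ and $\mathcal{G}\prec\mathcal{H}$. $e(\mathcal{G})=\liminf_n|E(G_n)|/|V(G_n)|$ and $c(\mathcal{G})=\inf_{\mathcal{H}\simeq\mathcal{G}}e(\mathcal{H})$. *)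

theory Defs
  imports "HOL-Algebra.Algebra" "HOL-Library.Extended_Real" "HOL-Library.Extended_Nat"
begin

definition simple_graph :: "'v set \<Rightarrow> 'v set set \<Rightarrow> bool" where
  "simple_graph V E \<longleftrightarrow> finite V \<and>
     E \<subseteq> {e. \<exists>x y. x \<in> V \<and> y \<in> V \<and> x \<noteq> y \<and> e = {x, y}}"

definition graph_degree :: "'v set set \<Rightarrow> 'v \<Rightarrow> nat" where
  "graph_degree E x = card {y. {x, y} \<in> E}"

definition graph_sequence :: "(nat \<Rightarrow> 'v set) \<Rightarrow> (nat \<Rightarrow> 'v set set) \<Rightarrow> bool" where
  "graph_sequence V E \<longleftrightarrow>
     (\<forall>n. simple_graph (V n) (E n)) \<and>
     (\<exists>D::nat. \<forall>n. \<forall>x \<in> V n. graph_degree (E n) x \<le> D) \<and>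
     filterlim (\<lambda>n. card (V n)) at_top sequentially"

text \<open>Walks of length m (m edges) from x to y, and the shortest path metric
  (infinite if there is no path).\<close>

definition is_walk :: "'v set set \<Rightarrow> 'v list \<Rightarrow> 'v \<Rightarrow> 'v \<Rightarrow> bool" where
  "is_walk E p x y \<longleftrightarrow> p \<noteq> [] \<and> hd p = x \<and> last p = y \<and>
     (\<forall>i. Suc i < length p \<longrightarrow> {p ! i, p ! Suc i} \<in> E)"

definition graph_dist :: "'v set set \<Rightarrow> 'v \<Rightarrow> 'v \<Rightarrow> enat" where
  "graph_dist E x y = (INF p \<in> {p. is_walk E p x y}. enat (length p - 1))"

definition graph_seq_prec ::
  "(nat \<Rightarrow> 'v set) \<Rightarrow> (nat \<Rightarrow> 'v set set) \<Rightarrow> (nat \<Rightarrow> 'v set set) \<Rightarrow> bool" where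
  "graph_seq_prec V EH EG \<longleftrightarrow> (\<exists>L::nat. L > 0 \<and>
     (\<forall>n. \<forall>x \<in> V n. \<forall>y \<in> V n. graph_dist (EG n) x y \<le> enat L * graph_dist (EH n) x y))"

definition graph_seq_equiv ::
  "(nat \<Rightarrow> 'v set) \<Rightarrow> (nat \<Rightarrow> 'v set set) \<Rightarrow> (nat \<Rightarrow> 'v set set) \<Rightarrow> bool" where
  "graph_seq_equiv V EG EH \<longleftrightarrow> graph_seq_prec V EH EG \<and> graph_seq_prec V EG EH"

definition edge_ratio :: "(nat \<Rightarrow> 'v set) \<Rightarrow> (nat \<Rightarrow> 'v set set) \<Rightarrow> ereal" where
  "edge_ratio V E = liminf (\<lambda>n. ereal (real (card (E n)) / real (card (V n))))"

definition cost :: "(nat \<Rightarrow> 'v set) \<Rightarrow> (nat \<Rightarrow> 'v set set) \<Rightarrow> ereal" where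
  "cost V EG = (INF EH \<in> {EH. graph_sequence V EH \<and> graph_seq_equiv V EG EH}. edge_ratio V EH)"

definition cayley_edges :: "('a, 'b) monoid_scheme \<Rightarrow> 'a set \<Rightarrow> 'a set \<Rightarrow> 'a set set set" where
  "cayley_edges G N S = {{x, y} | x y. x \<in> rcosets\<^bsub>G\<^esub> N \<and> y \<in> rcosets\<^bsub>G\<^esub> N \<and> x \<noteq> y \<and>
     (\<exists>s \<in> S. y = (N #>\<^bsub>G\<^esub> s) <#>\<^bsub>G\<^esub> x \<or> x = (N #>\<^bsub>G\<^esub> s) <#>\<^bsub>G\<^esub> y)}"

definition min_generators :: "('a, 'b) monoid_scheme \<Rightarrow> 'a set \<Rightarrow> nat" where
  "min_generators G H = (LEAST m. \<exists>T. T \<subseteq> H \<and> finite T \<and> card T = m \<and> generate G T = H)"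

end

theory Submission
  imports Defs
begin

text \<open>Let \<open>K = \<Gamma>\<^sub>k\<close>, let \<open>T\<close> be a generating set of \<open>K\<close> with \<open>d(K)\<close> elements and \<open>R\<close> a transversal of
  \<open>K\<close> in \<open>\<Gamma>\<close> containing \<open>1\<close>. In \<open>\<Gamma>/\<Gamma>\<^sub>n\<close> join every vertex \<open>h\<close> of \<open>K/\<Gamma>\<^sub>n\<close> to \<open>t h\<close> for \<open>t \<in> T\<close> and to
  \<open>r h\<close> for \<open>r \<in> R\<close>. This graph has at most \<open>|K : \<Gamma>\<^sub>n| (d(K) + |\<Gamma> : K|)\<close> edges, which is the claimed
  ratio because \<open>|\<Gamma> : \<Gamma>\<^sub>n| = |K : \<Gamma>\<^sub>n| |\<Gamma> : K|\<close>. It is equivalent to the Cayley graph: a Cayley edge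
  from \<open>r h\<close> to \<open>s r h = r' t h\<close> is replaced by the path \<open>r h, h, \<dots>, t h, r' t h\<close> whose middle part spells the
  element \<open>t = r'\<^sup>-\<^sup>1 s r\<close> of \<open>K\<close> in the generators \<open>T\<close>, and only finitely many \<open>t\<close> occur. That \<open>d(K)\<close> is
  finite, so that the least number of generators is attained, is Schreier's lemma.\<close>

section \<open>Graph distances\<close>

lemma is_walk_successively:
  "is_walk E p x y \<longleftrightarrow>
     p \<noteq> [] \<and> hd p = x \<and> last p = y \<and> successively (\<lambda>a b. {a, b} \<in> E) p"
  by (auto simp: is_walk_def successively_conv_nth)

text \<open>The distance is an infimum in \<open>enat\<close>, infinite when no walk exists. A
  finite bound turns it into the existence of one walk, and the later estimates are stated as such
  bounds. The list counts vertices, hence \<open>Suc m\<close>.\<close>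

lemma graph_dist_le_iff:
  "graph_dist E x y \<le> enat m \<longleftrightarrow> (\<exists>p. is_walk E p x y \<and> length p \<le> Suc m)"
proof -
  \<comment> \<open>An infimum strictly below a bound has a member below it, so the inequality is
    first made strict.\<close>
  have "graph_dist E x y \<le> enat m \<longleftrightarrow> graph_dist E x y < enat (Suc m)"
    by (cases "graph_dist E x y") auto
  also have "\<dots> \<longleftrightarrow> (\<exists>p. is_walk E p x y \<and> length p - 1 < Suc m)"
    unfolding graph_dist_def INF_less_iff by auto
  also have "\<dots> \<longleftrightarrow> (\<exists>p. is_walk E p x y \<and> length p \<le> Suc m)"
    by (metis One_nat_def Suc_pred is_walk_def le_simps(2) length_greater_0_conv Suc_le_mono)
  finally show ?thesis .
qed

lemma graph_dist_refl: "graph_dist E x x \<le> enat m"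
  unfolding graph_dist_le_iff by (rule exI[of _ "[x]"]) (simp add: is_walk_def)

lemma graph_dist_edge:
  assumes "{x, y} \<in> E"
  shows "graph_dist E x y \<le> enat 1"
  unfolding graph_dist_le_iff
  by (rule exI[of _ "[x, y]"]) (use assms in \<open>simp add: is_walk_successively\<close>)

lemma graph_dist_sym:
  assumes "graph_dist E x y \<le> enat m"
  shows "graph_dist E y x \<le> enat m"
proof -
  obtain p where "is_walk E p x y" "length p \<le> Suc m"
    using assms unfolding graph_dist_le_iff by blast
  then have "is_walk E (rev p) y x \<and> length (rev p) \<le> Suc m"
    by (auto simp: is_walk_successively hd_rev last_rev insert_commute)
  then show ?thesis
    unfolding graph_dist_le_iff by blast
qed

lemma graph_dist_trans:
  assumes "graph_dist E x y \<le> enat m" and "graph_dist E y z \<le> enat l"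
  shows "graph_dist E x z \<le> enat (m + l)"
proof -
  obtain p where p: "is_walk E p x y" "length p \<le> Suc m"
    using assms(1) unfolding graph_dist_le_iff by blast
  obtain q where q: "is_walk E q y z" "length q \<le> Suc l"
    using assms(2) unfolding graph_dist_le_iff by blast
  obtain q' where q': "q = y # q'"
    using q(1) by (cases q) (auto simp: is_walk_def)
  have "is_walk E (p @ q') x z"
    using p(1) q(1) unfolding q' is_walk_successively
    by (cases q') (auto simp: successively_append_iff)
  moreover have "length (p @ q') \<le> Suc (m + l)"
    using p(2) q(2) by (simp add: q')
  ultimately show ?thesis
    unfolding graph_dist_le_iff by blast
qed

lemma graph_dist_mono:
  assumes "graph_dist E x y \<le> enat m" and "m \<le> l"
  shows "graph_dist E x y \<le> enat l"
  using assms order_trans by fastforce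

text \<open>Replacing every edge of a walk by a walk of length at most \<open>L\<close> stretches it
  by at most the factor \<open>L\<close>. So comparing the two metrics reduces to checking single
  edges.\<close>

lemma graph_dist_le_mult:
  assumes edge: "\<And>x y. {x, y} \<in> EH \<Longrightarrow> graph_dist EG x y \<le> enat L" and "L > 0"
  shows "graph_dist EG x y \<le> enat L * graph_dist EH x y"
proof (cases "graph_dist EH x y")
  case (enat m)
  then obtain p where p: "is_walk EH p x y" "length p \<le> Suc m"
    using graph_dist_le_iff[of EH x y m] by auto
  \<comment> \<open>The endpoints are expressed through \<open>p\<close>, so that the tail of a walk
    is again an instance of the claim.\<close>
  have "graph_dist EG (hd p) (last p) \<le> enat (L * (length p - 1))"
    if "p \<noteq> []" "successively (\<lambda>a b. {a, b} \<in> EH) p" for p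
    using that
  proof (induction p rule: induct_list012)
    case (3 a b p)
    have "graph_dist EG a b \<le> enat L"
      using 3 edge by simp
    moreover have "graph_dist EG b (last (b # p)) \<le> enat (L * length p)"
      using 3 by simp
    ultimately have "graph_dist EG a (last (b # p)) \<le> enat (L + L * length p)"
      by (rule graph_dist_trans)
    then show ?case by simp
  qed (simp_all add: graph_dist_refl)
  then have "graph_dist EG x y \<le> enat (L * (length p - 1))"
    using p(1) by (auto simp: is_walk_successively)
  then have "graph_dist EG x y \<le> enat (L * m)"
    using p(2) by (elim graph_dist_mono) auto
  then show ?thesis
    by (simp add: enat)
next
  case infinity
  \<comment> \<open>In \<open>enat\<close> the product of 0 and infinity is 0; positivity of
    \<open>L\<close> keeps the right-hand side infinite.\<close>
  then show ?thesis
    using \<open>L > 0\<close> by (simp add: enat_0_iff)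
qed

lemma graph_seq_precI:
  assumes "\<And>n x y. {x, y} \<in> EH n \<Longrightarrow> graph_dist (EG n) x y \<le> enat L" and "L > 0"
  shows "graph_seq_prec V EH EG"
  unfolding graph_seq_prec_def
  by (intro exI[of _ L] conjI allI ballI graph_dist_le_mult assms)

section \<open>Transversals and Schreier's lemma\<close>

context group
begin

text \<open>One element is chosen in each coset. Representatives are compared by
  \<open>inv r \<otimes> g \<in> K\<close>, so that every \<open>g\<close> splits as
  \<open>r \<otimes> h\<close> with \<open>h\<close> in \<open>K\<close>; normality reconciles this
  with the right cosets that are counted.\<close>

lemma ex_transversal:
  assumes "K \<lhd> G"
  obtains R where "R \<subseteq> carrier G" "card R = card (rcosets K)" "\<one> \<in> R"
    "\<And>g. g \<in> carrier G \<Longrightarrow> \<exists>r\<in>R. inv r \<otimes> g \<in> K"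
    "\<And>r r'. r \<in> R \<Longrightarrow> r' \<in> R \<Longrightarrow> inv r \<otimes> r' \<in> K \<Longrightarrow> r = r'"
    "finite (rcosets K) \<Longrightarrow> finite R"
proof -
  interpret K: normal K G by fact
  have sub: "subgroup K G" by (rule K.subgroup_axioms)
  \<comment> \<open>The coset \<open>K\<close> itself gets the representative \<open>\<one>\<close>,
    which Schreier's argument relies on.\<close>
  define f where "f C = (if C = K then \<one> else SOME x. x \<in> C)" for C
  have fC: "f C \<in> C" if "C \<in> rcosets K" for C
  proof -
    obtain a where "a \<in> carrier G" "C = K #> a"
      using \<open>C \<in> rcosets K\<close> unfolding RCOSETS_def by blast
    then have "a \<in> C"
      using rcos_self[OF _ sub] by simp
    then show ?thesis
      unfolding f_def by (auto intro: someI)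
  qed
  have car: "f C \<in> carrier G" if "C \<in> rcosets K" for C
    using fC[OF that] K.rcosets_carrier[OF is_group that] by blast
  have coset: "K #> f C = C" if "C \<in> rcosets K" for C
  proof -
    obtain a where "a \<in> carrier G" "C = K #> a"
      using \<open>C \<in> rcosets K\<close> unfolding RCOSETS_def by blast
    then show ?thesis
      using repr_independence[OF _ _ sub, of "f C" a] fC[OF that] by simp
  qed
  have inK: "inv x \<otimes> y \<in> K \<longleftrightarrow> K #> x = K #> y" if "x \<in> carrier G" "y \<in> carrier G" for x y
  proof
    assume "inv x \<otimes> y \<in> K"
    then have "x \<otimes> (inv x \<otimes> y) \<in> x <# K"
      by (auto simp: l_coset_def)
    then have "y \<in> K #> x"
      using that K.coset_eq by (simp add: m_assoc[symmetric])
    then show "K #> x = K #> y"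
      using repr_independence[OF _ _ sub] that by blast
  next
    assume "K #> x = K #> y"
    then have "y \<in> x <# K"
      using that K.coset_eq rcos_self[OF _ sub] by auto
    then obtain h where "h \<in> K" "y = x \<otimes> h"
      by (auto simp: l_coset_def)
    then show "inv x \<otimes> y \<in> K"
      using that by (simp add: m_assoc[symmetric])
  qed
  have "inj_on f (rcosets K)"
    by (metis coset inj_onI)
  moreover have "K \<in> rcosets K"
    using K.subgroup_in_rcosets[OF is_group] .
  ultimately show ?thesis
  proof (intro that[of "f ` (rcosets K)"])
    fix g assume g: "g \<in> carrier G"
    then have "K #> g \<in> rcosets K"
      using rcosetsI[OF K.subset] by blast
    then show "\<exists>r\<in>f ` (rcosets K). inv r \<otimes> g \<in> K"
      using inK[OF car g] coset by blast
  next
    fix r r' assume "r \<in> f ` (rcosets K)" "r' \<in> f ` (rcosets K)" "inv r \<otimes> r' \<in> K"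
    then show "r = r'"
      using inK car coset by auto
  next
    show "\<one> \<in> f ` (rcosets K)"
      using \<open>K \<in> rcosets K\<close> by (force simp: f_def)
  qed (auto simp: car card_image)
qed

text \<open>Schreier's argument: for a transversal \<open>R\<close> and the Schreier generators
  \<open>T\<close>, the product set of \<open>R\<close> and \<open>generate G T\<close> contains
  \<open>\<one>\<close> and is stable under left multiplication by words in \<open>S\<close>, hence
  is the whole group. An element of \<open>K\<close> in it has a representative in \<open>K\<close>,
  which must be \<open>\<one>\<close>.\<close>

lemma finite_index_imp_finitely_generated:
  assumes "finite S" "S \<subseteq> carrier G" "generate G S = carrier G"
    and "K \<lhd> G" "finite (rcosets K)"
  shows "\<exists>T. finite T \<and> T \<subseteq> K \<and> generate G T = K"
proof -
  interpret K: normal K G by fact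
  obtain R where R: "R \<subseteq> carrier G" "\<one> \<in> R" "finite R"
    and ex: "\<And>g. g \<in> carrier G \<Longrightarrow> \<exists>r\<in>R. inv r \<otimes> g \<in> K"
    and un: "\<And>r r'. r \<in> R \<Longrightarrow> r' \<in> R \<Longrightarrow> inv r \<otimes> r' \<in> K \<Longrightarrow> r = r'"
    using ex_transversal[OF \<open>K \<lhd> G\<close>] assms(5) by metis
  \<comment> \<open>For given \<open>s\<close> and \<open>r\<close> exactly one \<open>r'\<close>
    puts this product into \<open>K\<close>, so intersecting with \<open>K\<close> replaces a choice
    of representative function.\<close>
  define T where "T = (\<lambda>(r', s, r). inv r' \<otimes> (s \<otimes> r)) ` (R \<times> S \<times> R) \<inter> K"
  have TK: "T \<subseteq> K" and "finite T"
    using R assms(1) by (auto simp: T_def)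
  have TG: "T \<subseteq> carrier G"
    using TK K.subset by blast
  have WK: "generate G T \<subseteq> K"
    using generate_subgroup_incl[OF TK K.subgroup_axioms] .
  define RW where "RW = {r \<otimes> w | r w. r \<in> R \<and> w \<in> generate G T}"
  have RWI: "g \<otimes> (r \<otimes> w) \<in> RW"
    if "g \<in> carrier G" "r \<in> R" "r' \<in> R" "w \<in> generate G T" "inv r' \<otimes> (g \<otimes> r) \<in> generate G T"
    for g r r' w
  proof -
    have c: "r \<in> carrier G" "r' \<in> carrier G" "w \<in> carrier G"
      using that R WK K.subset by auto
    have "g \<otimes> (r \<otimes> w) = r' \<otimes> ((inv r' \<otimes> (g \<otimes> r)) \<otimes> w)"
      using c that(1) by (simp add: m_assoc[symmetric])
    then show ?thesis
      using that generate.eng[OF that(5,4)] unfolding RW_def by blast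
  qed
  have RWG: "RW \<subseteq> carrier G"
  proof
    fix x assume "x \<in> RW"
    then obtain r w where "x = r \<otimes> w" "r \<in> R" "w \<in> generate G T"
      by (auto simp: RW_def)
    moreover have "w \<in> carrier G"
      using calculation WK K.subset by blast
    ultimately show "x \<in> carrier G"
      using R by auto
  qed
  have step: "g \<otimes> x \<in> RW" if "g \<in> generate G S" "x \<in> RW" for g x
    using that
  proof (induction arbitrary: x rule: generate.induct)
    case one
    then show ?case
      using RWG by auto
  next
    case (incl s)
    then obtain r w where x: "x = r \<otimes> w" "r \<in> R" "w \<in> generate G T"
      by (auto simp: RW_def)
    have c: "s \<in> carrier G" "r \<in> carrier G"
      using x incl R assms(2) by auto
    obtain r' where r': "r' \<in> R" "inv r' \<otimes> (s \<otimes> r) \<in> K"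
      using ex[of "s \<otimes> r"] c by auto
    then have "inv r' \<otimes> (s \<otimes> r) \<in> T"
      using incl x unfolding T_def by (intro IntI image_eqI[of _ _ "(r', s, r)"]) auto
    then show ?case
      unfolding x(1) by (intro RWI[OF c(1) x(2) r'(1) x(3)] generate.incl)
  next
    case (inv s)
    then obtain r w where x: "x = r \<otimes> w" "r \<in> R" "w \<in> generate G T"
      by (auto simp: RW_def)
    have c: "s \<in> carrier G" "r \<in> carrier G"
      using x inv R assms(2) by auto
    obtain r' where r': "r' \<in> R" "inv r' \<otimes> (inv s \<otimes> r) \<in> K"
      using ex[of "inv s \<otimes> r"] c by auto
    have c': "r' \<in> carrier G"
      using r' R by auto
    \<comment> \<open>For an inverse letter the required element of \<open>K\<close> is the inverse
      of the Schreier generator with \<open>r\<close> and \<open>r'\<close> exchanged.\<close>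
    have eq: "inv (inv r' \<otimes> (inv s \<otimes> r)) = inv r \<otimes> (s \<otimes> r')"
      using c c' by (simp add: inv_mult_group m_assoc)
    then have "inv r \<otimes> (s \<otimes> r') \<in> K"
      using r'(2) K.m_inv_closed by metis
    then have "inv r \<otimes> (s \<otimes> r') \<in> T"
      using inv x r' unfolding T_def by (intro IntI image_eqI[of _ _ "(r, s, r')"]) auto
    then have "inv (inv r \<otimes> (s \<otimes> r')) \<in> generate G T"
      by (rule generate.inv)
    moreover have "inv (inv r \<otimes> (s \<otimes> r')) = inv r' \<otimes> (inv s \<otimes> r)"
      using c c' by (simp add: inv_mult_group m_assoc)
    ultimately show ?case
      unfolding x(1) using RWI[OF _ x(2) r'(1) x(3)] c by simp
  next
    case (eng g h)
    have "g \<in> carrier G" "h \<in> carrier G"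
      using eng assms(3) by auto
    moreover have "x \<in> carrier G"
      using eng(5) RWG by blast
    ultimately show ?case
      using eng by (simp add: m_assoc)
  qed
  have "K \<subseteq> generate G T"
  proof
    fix g assume g: "g \<in> K"
    have "\<one> \<in> RW"
      using R generate.one[of G T] unfolding RW_def by force
    then have "g \<otimes> \<one> \<in> RW"
      using step[of g \<one>] g assms(3) K.subset by auto
    then obtain r w where rw: "g = r \<otimes> w" "r \<in> R" "w \<in> generate G T"
      using g K.subset by (auto simp: RW_def)
    have c: "r \<in> carrier G" "w \<in> carrier G" "w \<in> K"
      using rw R WK K.subset by auto
    have "r = g \<otimes> inv w"
      using rw c by (simp add: m_assoc)
    then have "r \<in> K"
      using g c by simp
    \<comment> \<open>Both \<open>r\<close> and \<open>\<one>\<close> belong to \<open>R\<close> and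
      represent the coset \<open>K\<close>.\<close>
    then have "r = \<one>"
      using un[of \<one> r] R rw c by simp
    then show "g \<in> generate G T"
      using rw c by simp
  qed
  then show ?thesis
    using WK TK \<open>finite T\<close> by blast
qed

section \<open>Restricted Cayley graphs\<close>

text \<open>Labels in \<open>U\<close> act only on vertices represented in \<open>A\<close>. Taking
  \<open>A\<close> to be the whole group gives the Cayley graph, and \<open>A = K\<close> gives the
  sparse graph, so both share the same distance lemmas.\<close>

definition restricted_cayley_edges :: "'a set \<Rightarrow> 'a set \<Rightarrow> 'a set \<Rightarrow> 'a set set set" where
  "restricted_cayley_edges M A U =
     {{M #> h, M #> (u \<otimes> h)} | h u. h \<in> A \<and> u \<in> U \<and> M #> h \<noteq> M #> (u \<otimes> h)}"

lemma restricted_cayley_edgesE: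
  assumes "{x, y} \<in> restricted_cayley_edges M A U"
  obtains h u where "h \<in> A" "u \<in> U"
    "x = M #> h \<and> y = M #> (u \<otimes> h) \<or> x = M #> (u \<otimes> h) \<and> y = M #> h"
  using assms unfolding restricted_cayley_edges_def by (auto simp: doubleton_eq_iff)

lemma cayley_edges_eq_restricted:
  assumes "M \<lhd> G" and "U \<subseteq> carrier G"
  shows "cayley_edges G M U = restricted_cayley_edges M (carrier G) U"
proof -
  interpret M: normal M G by fact
  have act: "(M #> u) <#> (M #> g) = M #> (u \<otimes> g)" if "u \<in> U" "g \<in> carrier G" for u g
    using M.rcos_sum that assms(2) by blast
  show ?thesis
  proof (intro equalityI subsetI)
    fix e assume "e \<in> cayley_edges G M U"
    then obtain x y s where "e = {x, y}" "x \<in> rcosets M" "y \<in> rcosets M" "x \<noteq> y" "s \<in> U"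
      "y = (M #> s) <#> x \<or> x = (M #> s) <#> y"
      unfolding cayley_edges_def by blast
    \<comment> \<open>The edge is unordered, so its endpoints may be renamed to make the label lead
      from \<open>x\<close> to \<open>y\<close>.\<close>
    then obtain x y where e: "e = {x, y}" "x \<in> rcosets M" "x \<noteq> y" "y = (M #> s) <#> x"
      by blast
    then obtain g where "g \<in> carrier G" "x = M #> g"
      by (auto simp: RCOSETS_def)
    then show "e \<in> restricted_cayley_edges M (carrier G) U"
      unfolding restricted_cayley_edges_def using e act \<open>s \<in> U\<close> by blast
  next
    fix e assume "e \<in> restricted_cayley_edges M (carrier G) U"
    then obtain h u where e: "e = {M #> h, M #> (u \<otimes> h)}" "h \<in> carrier G" "u \<in> U"
      "M #> h \<noteq> M #> (u \<otimes> h)"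
      unfolding restricted_cayley_edges_def by blast
    moreover have "M #> h \<in> rcosets M" "M #> (u \<otimes> h) \<in> rcosets M"
      using e assms(2) rcosetsI[OF M.subset] by blast+
    ultimately show "e \<in> cayley_edges G M U"
      unfolding cayley_edges_def using act[OF e(3,2)] by blast
  qed
qed

lemma simple_graph_restricted:
  assumes "M \<lhd> G" "A \<subseteq> carrier G" "U \<subseteq> carrier G" "finite (rcosets M)"
  shows "simple_graph (rcosets M) (restricted_cayley_edges M A U)"
proof -
  interpret M: normal M G by fact
  have "M #> h \<in> rcosets M \<and> M #> (u \<otimes> h) \<in> rcosets M" if "h \<in> A" "u \<in> U" for h u
    using that assms(2,3) rcosetsI[OF M.subset] by blast
  then show ?thesis
    using assms(4) unfolding simple_graph_def restricted_cayley_edges_def by blast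
qed

text \<open>A neighbour of \<open>x\<close> arises by multiplying \<open>x\<close> by some
  \<open>u\<close> or its inverse. The bound does not involve \<open>M\<close>, which gives
  uniformly bounded degrees along the sequence.\<close>

lemma graph_degree_restricted_le:
  assumes "M \<lhd> G" "A \<subseteq> carrier G" "U \<subseteq> carrier G" "finite U"
  shows "graph_degree (restricted_cayley_edges M A U) x \<le> 2 * card U"
proof -
  interpret M: normal M G by fact
  let ?B = "(\<lambda>u. (M #> u) <#> x) ` U \<union> (\<lambda>u. (M #> inv u) <#> x) ` U"
  have "y \<in> ?B" if "{x, y} \<in> restricted_cayley_edges M A U" for y
  proof -
    obtain h u where hu: "h \<in> carrier G" "u \<in> U"
      "x = M #> h \<and> y = M #> (u \<otimes> h) \<or> x = M #> (u \<otimes> h) \<and> y = M #> h"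
      using \<open>{x, y} \<in> _\<close> assms(2) by (elim restricted_cayley_edgesE) blast
    then have c: "u \<in> carrier G"
      using assms(3) by blast
    have "M #> (u \<otimes> h) = (M #> u) <#> (M #> h)"
      using M.rcos_sum hu c by simp
    moreover have "M #> h = (M #> inv u) <#> (M #> (u \<otimes> h))"
      using M.rcos_sum hu c by (simp add: m_assoc[symmetric])
    ultimately show ?thesis
      using hu(2,3) by auto
  qed
  then have "{y. {x, y} \<in> restricted_cayley_edges M A U} \<subseteq> ?B"
    by blast
  then have "graph_degree (restricted_cayley_edges M A U) x \<le> card ?B"
    unfolding graph_degree_def by (rule card_mono[rotated]) (simp add: assms(4))
  also have "\<dots> \<le> card U + card U"
    by (rule order_trans[OF card_Un_le]) (intro add_mono card_image_le assms(4))
  finally show ?thesis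
    by simp
qed

section \<open>Distances along words in the generators\<close>

lemma graph_dist_restricted_generator:
  assumes "h \<in> A" "u \<in> U"
  shows "graph_dist (restricted_cayley_edges M A U) (M #> h) (M #> (u \<otimes> h)) \<le> enat 1"
proof (cases "M #> h = M #> (u \<otimes> h)")
  case False
  then have "{M #> h, M #> (u \<otimes> h)} \<in> restricted_cayley_edges M A U"
    unfolding restricted_cayley_edges_def using assms by blast
  then show ?thesis
    by (rule graph_dist_edge)
next
  case True
  show ?thesis
    unfolding True[symmetric] by (rule graph_dist_refl)
qed

text \<open>Spelling \<open>g\<close> in the letters \<open>T\<close> and their inverses gives a
  walk that never leaves \<open>A\<close>, since \<open>A\<close> is a subgroup containing
  \<open>T\<close>. The bound is chosen before \<open>M\<close> and \<open>h\<close>, so it serves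
  all quotients at once.\<close>

lemma graph_dist_restricted_word:
  assumes "subgroup A G" "T \<subseteq> A" "T \<subseteq> U" "g \<in> generate G T"
  shows "\<exists>m. \<forall>M. \<forall>h\<in>A.
    graph_dist (restricted_cayley_edges M A U) (M #> h) (M #> (g \<otimes> h)) \<le> enat m"
  using assms(4)
proof (induction rule: generate.induct)
  case one
  show ?case
    using subgroup.subset[OF assms(1)] graph_dist_refl by (metis l_one subset_iff)
next
  case (incl t)
  then show ?case
    using assms graph_dist_restricted_generator by blast
next
  case (inv t)
  have "graph_dist (restricted_cayley_edges M A U) (M #> h) (M #> (inv t \<otimes> h)) \<le> enat 1"
    if "h \<in> A" for M h
  proof -
    have t: "t \<in> A" "t \<in> carrier G" "h \<in> carrier G"
      using inv that assms(2) subgroup.subset[OF assms(1)] by auto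
    \<comment> \<open>The edge is traversed backwards: its label \<open>t\<close> acts on
      \<open>inv t \<otimes> h\<close>, which must therefore lie in \<open>A\<close>.\<close>
    have "inv t \<otimes> h \<in> A"
      using t that assms(1) by (simp add: subgroup.m_closed subgroup.m_inv_closed)
    then have "graph_dist (restricted_cayley_edges M A U)
        (M #> (inv t \<otimes> h)) (M #> (t \<otimes> (inv t \<otimes> h))) \<le> enat 1"
      by (rule graph_dist_restricted_generator) (use inv assms(3) in auto)
    then show ?thesis
      using t by (subst (asm) m_assoc[symmetric]) (auto intro: graph_dist_sym)
  qed
  then show ?case by blast
next
  case (eng a b)
  obtain m l where
    m: "\<And>M h. h \<in> A \<Longrightarrow>
      graph_dist (restricted_cayley_edges M A U) (M #> h) (M #> (a \<otimes> h)) \<le> enat m" and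
    l: "\<And>M h. h \<in> A \<Longrightarrow>
      graph_dist (restricted_cayley_edges M A U) (M #> h) (M #> (b \<otimes> h)) \<le> enat l"
    using eng.IH by blast
  have "graph_dist (restricted_cayley_edges M A U) (M #> h) (M #> (a \<otimes> b \<otimes> h)) \<le> enat (l + m)"
    if "h \<in> A" for M h
  proof -
    have gA: "a \<in> A" "b \<in> A"
      using eng generate_subgroup_incl[OF assms(2,1)] by auto
    then have "b \<otimes> h \<in> A"
      using that assms(1) by (simp add: subgroup.m_closed)
    moreover have "a \<otimes> b \<otimes> h = a \<otimes> (b \<otimes> h)"
      using gA that subgroup.subset[OF assms(1)] by (intro m_assoc) auto
    ultimately show ?thesis
      using graph_dist_trans[OF l m] that by metis
  qed
  then show ?case by blast
qed

lemma graph_dist_restricted_words: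
  assumes "subgroup A G" "T \<subseteq> A" "T \<subseteq> U" "finite F" "F \<subseteq> generate G T"
  shows "\<exists>m. \<forall>M. \<forall>h\<in>A. \<forall>g\<in>F.
    graph_dist (restricted_cayley_edges M A U) (M #> h) (M #> (g \<otimes> h)) \<le> enat m"
proof -
  have "\<forall>g\<in>F. \<exists>m. \<forall>M. \<forall>h\<in>A.
    graph_dist (restricted_cayley_edges M A U) (M #> h) (M #> (g \<otimes> h)) \<le> enat m"
    using graph_dist_restricted_word[OF assms(1-3) subsetD[OF assms(5)]] by (rule ballI)
  then obtain f where f: "\<And>g M h. g \<in> F \<Longrightarrow> h \<in> A \<Longrightarrow>
    graph_dist (restricted_cayley_edges M A U) (M #> h) (M #> (g \<otimes> h)) \<le> enat (f g)"
    by metis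
  \<comment> \<open>The sum is a common bound that also makes sense for empty
    \<open>F\<close>.\<close>
  have "f g \<le> sum f F" if "g \<in> F" for g
    using assms(4) that by (simp add: member_le_sum)
  then show ?thesis
    by (intro exI[of _ "sum f F"] allI ballI graph_dist_mono[OF f])
qed

section \<open>Counting cosets\<close>

text \<open>Sending a coset of \<open>M\<close> in \<open>K\<close> and a representative
  \<open>r\<close> to their product is injective, because the \<open>r\<close> lie in different
  cosets of \<open>K\<close>.\<close>

lemma card_rcosets_subgroup_mult_le:
  assumes M: "M \<lhd> G" and K: "K \<lhd> G" and "M \<subseteq> K" "finite (rcosets M)"
    and R: "R \<subseteq> carrier G"
    and un: "\<And>r r'. r \<in> R \<Longrightarrow> r' \<in> R \<Longrightarrow> inv r \<otimes> r' \<in> K \<Longrightarrow> r = r'"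
  shows "card ((\<lambda>h. M #> h) ` K) * card R \<le> card (rcosets M)"
proof -
  interpret M: normal M G by fact
  interpret K: normal K G by fact
  let ?f = "\<lambda>(v, r). (M #> r) <#> v"
  have f: "?f (M #> h, r) = M #> (r \<otimes> h)" if "h \<in> K" "r \<in> R" for h r
    using that R K.subset M.rcos_sum by auto
  have "inj_on ?f ((\<lambda>h. M #> h) ` K \<times> R)"
  proof (rule inj_onI, clarify)
    fix h r h' r'
    assume h: "h \<in> K" "h' \<in> K" and r: "r \<in> R" "r' \<in> R"
      and "(M #> r) <#> (M #> h) = (M #> r') <#> (M #> h')"
    then have eq: "M #> (r \<otimes> h) = M #> (r' \<otimes> h')"
      using f by auto
    have c: "h \<in> carrier G" "h' \<in> carrier G" "r \<in> carrier G" "r' \<in> carrier G"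
      using h r R K.subset by auto
    have "r' \<otimes> h' \<in> M #> (r \<otimes> h)"
      using eq c rcos_self[OF _ M.subgroup_axioms] by simp
    then have "r' \<otimes> h' \<in> (r \<otimes> h) <# M"
      using M.coset_eq c by simp
    then obtain x where x: "x \<in> M" "r' \<otimes> h' = r \<otimes> h \<otimes> x"
      by (auto simp: l_coset_def)
    have cx: "x \<in> carrier G" "x \<in> K"
      using x assms(3) M.subset by auto
    \<comment> \<open>Since \<open>M\<close> lies in \<open>K\<close>, the factor between
      \<open>r\<close> and \<open>r'\<close> is in \<open>K\<close>, which forces them to
      agree.\<close>
    have "r' = r \<otimes> (h \<otimes> x \<otimes> inv h')"
      using x c cx by (metis inv_closed inv_solve_right m_assoc m_closed)
    then have "inv r \<otimes> r' = h \<otimes> x \<otimes> inv h'"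
      using c cx by (simp add: m_assoc[symmetric])
    then have rr: "r = r'"
      using un r h cx by simp
    then have "h' = h \<otimes> x"
      using x c cx by (simp add: m_assoc)
    then have "h' \<in> M #> h"
      using M.coset_eq c x by (auto simp: l_coset_def)
    then show "M #> h = M #> h' \<and> r = r'"
      using rr repr_independence[OF _ _ M.subgroup_axioms] c by blast
  qed
  moreover have "?f ` ((\<lambda>h. M #> h) ` K \<times> R) \<subseteq> rcosets M"
    using f R K.subset rcosetsI[OF M.subset] by auto
  ultimately have "card ((\<lambda>h. M #> h) ` K \<times> R) \<le> card (rcosets M)"
    using card_inj_on_le assms(4) by blast
  then show ?thesis
    by (simp add: card_cartesian_product)
qed

text \<open>An edge is determined by its endpoint in the image of \<open>K\<close> and its
  label.\<close>

lemma card_restricted_cayley_edges_le: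
  assumes "M \<lhd> G" "K \<subseteq> carrier G" "finite (rcosets M)" "U \<subseteq> carrier G" "finite U"
  shows "card (restricted_cayley_edges M K U) \<le> card ((\<lambda>h. M #> h) ` K) * card U"
proof -
  interpret M: normal M G by fact
  have "(\<lambda>h. M #> h) ` K \<subseteq> rcosets M"
    using assms(2) rcosetsI[OF M.subset] by blast
  then have fin: "finite ((\<lambda>h. M #> h) ` K \<times> U)"
    using assms(3,5) finite_subset by blast
  have "M #> (u \<otimes> h) = (M #> u) <#> (M #> h)" if "h \<in> K" "u \<in> U" for h u
    using that assms M.rcos_sum by (metis subsetD)
  then have "restricted_cayley_edges M K U
      \<subseteq> (\<lambda>(v, u). {v, (M #> u) <#> v}) ` ((\<lambda>h. M #> h) ` K \<times> U)"
    unfolding restricted_cayley_edges_def by force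
  then have "card (restricted_cayley_edges M K U) \<le> card ((\<lambda>h. M #> h) ` K \<times> U)"
    using fin surj_card_le by blast
  then show ?thesis
    by (simp add: card_cartesian_product)
qed

text \<open>Any \<open>Z\<close> elements of the infinite group are eventually pairwise separated:
  each quotient \<open>x \<otimes> inv y\<close> of distinct ones avoids some \<open>N n0\<close>,
  and nestedness keeps it outside all later subgroups.\<close>

lemma card_rcosets_at_top:
  assumes "infinite (carrier G)" "\<And>n. N n \<lhd> G" "\<And>n. finite (rcosets (N n))"
    and "decseq N" and "(\<Inter>n. N n) = {\<one>}"
  shows "filterlim (\<lambda>n. card (rcosets (N n))) at_top sequentially"
  unfolding filterlim_at_top
proof
  fix Z :: nat
  obtain F where F: "F \<subseteq> carrier G" "finite F" "card F = Z"
    using infinite_arbitrarily_large[OF assms(1)] by blast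
  have ev: "\<forall>\<^sub>F n in sequentially. N n #> x \<noteq> N n #> y" if "x \<in> F" "y \<in> F" "x \<noteq> y" for x y
  proof -
    have c: "x \<in> carrier G" "y \<in> carrier G"
      using that F by auto
    then have "x \<otimes> inv y \<noteq> \<one>"
      using that inv_equality inv_inv by (metis inv_closed)
    then obtain n0 where n0: "x \<otimes> inv y \<notin> N n0"
      using assms(5) by blast
    have "N n #> x \<noteq> N n #> y" if "n \<ge> n0" for n
    proof
      interpret M: normal "N n" G by (rule assms(2))
      assume "N n #> x = N n #> y"
      then have "x \<in> N n #> y"
        using rcos_self[OF c(1) M.subgroup_axioms] by simp
      then obtain m where "m \<in> N n" "x = m \<otimes> y"
        by (auto simp: r_coset_def)
      then have "x \<otimes> inv y \<in> N n"
        using c M.subset by (auto simp: m_assoc subset_iff)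
      then show False
        using n0 decseqD[OF assms(4) that] by blast
    qed
    then show ?thesis
      using eventually_sequentially by blast
  qed
  have "\<forall>\<^sub>F n in sequentially. \<forall>(x, y) \<in> F \<times> F. x \<noteq> y \<longrightarrow> N n #> x \<noteq> N n #> y"
    using F(2) ev by (intro eventually_ball_finite) (auto intro: eventually_mono)
  then show "\<forall>\<^sub>F n in sequentially. Z \<le> card (rcosets (N n))"
  proof eventually_elim
    case (elim n)
    interpret M: normal "N n" G by (rule assms(2))
    have "inj_on (\<lambda>x. N n #> x) F"
      using elim by (auto simp: inj_on_def)
    moreover have "(\<lambda>x. N n #> x) ` F \<subseteq> rcosets (N n)"
      using F rcosetsI[OF M.subset] by blast
    ultimately show ?case
      using card_inj_on_le assms(3) F(3) by blast
  qed
qed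

end

section \<open>Minimal generating sets and the cost bound\<close>

lemma min_generators_attained:
  assumes "\<exists>T. finite T \<and> T \<subseteq> H \<and> generate G T = H"
  shows "\<exists>T. T \<subseteq> H \<and> finite T \<and> card T = min_generators G H \<and> generate G T = H"
  unfolding min_generators_def by (rule LeastI_ex) (use assms in blast)

theorem lemma3:
  fixes G :: "('a, 'b) monoid_scheme" and N :: "nat \<Rightarrow> 'a set" and S :: "'a set" and k :: nat
  assumes "group G"
    and "infinite (carrier G)"
    and "finite S" and "S \<subseteq> carrier G" and "generate G S = carrier G"
    and "\<And>n. N n \<lhd> G"
    and "\<And>n. finite (rcosets\<^bsub>G\<^esub> N n)"
    and "\<And>n. N (Suc n) \<subseteq> N n"
    and "(\<Inter>n. N n) = {\<one>\<^bsub>G\<^esub>}"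
  shows "ereal (real (min_generators G (N k)) / real (card (rcosets\<^bsub>G\<^esub> N k)) + 1)
           \<ge> cost (\<lambda>n. rcosets\<^bsub>G\<^esub> N n) (\<lambda>n. cayley_edges G (N n) S)"
proof -
  interpret group G by fact
  define K where "K = N k"
  have nK: "K \<lhd> G"
    using assms(6) by (simp add: K_def)
  interpret K: normal K G by fact
  have dec: "decseq N"
    using assms(8) by (rule decseq_SucI)
  obtain T where T: "T \<subseteq> K" "finite T" "card T = min_generators G K" "generate G T = K"
    using min_generators_attained[OF finite_index_imp_finitely_generated[OF assms(3-5) nK]]
      assms(7) by (auto simp: K_def)
  obtain R where R: "R \<subseteq> carrier G" "finite R" "card R = card (rcosets\<^bsub>G\<^esub> K)"
    and ex: "\<And>g. g \<in> carrier G \<Longrightarrow> \<exists>r\<in>R. inv\<^bsub>G\<^esub> r \<otimes>\<^bsub>G\<^esub> g \<in> K"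
    and un: "\<And>r r'. r \<in> R \<Longrightarrow> r' \<in> R \<Longrightarrow> inv\<^bsub>G\<^esub> r \<otimes>\<^bsub>G\<^esub> r' \<in> K \<Longrightarrow> r = r'"
    using ex_transversal[OF nK] assms(7) unfolding K_def by metis
  define U where "U = T \<union> R"
  have U: "U \<subseteq> carrier G" "finite U" "T \<subseteq> U" "R \<subseteq> U"
    using T R K.subset by (auto simp: U_def)
  define V where "V n = rcosets\<^bsub>G\<^esub> N n" for n
  define EG where "EG n = restricted_cayley_edges (N n) (carrier G) S" for n
  define EH where "EH n = restricted_cayley_edges (N n) K U" for n
  have EG: "EG = (\<lambda>n. cayley_edges G (N n) S)"
    unfolding EG_def using cayley_edges_eq_restricted[OF assms(6) assms(4)] by simp

  have "graph_sequence V EH"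
    unfolding graph_sequence_def V_def EH_def
    using simple_graph_restricted[OF assms(6) K.subset U(1) assms(7)]
      graph_degree_restricted_le[OF assms(6) K.subset U(1,2)]
      card_rcosets_at_top[OF assms(2) assms(6,7) dec assms(9)] by blast
  moreover have "graph_seq_prec V EH EG"
  proof -
    have US: "U \<subseteq> generate G S"
      using U(1) assms(5) by simp
    \<comment> \<open>Each of the finitely many labels in \<open>U\<close> is a word in
      \<open>S\<close>, so one length bound serves all of them and all \<open>n\<close>.\<close>
    obtain m where m: "\<And>M h g. h \<in> carrier G \<Longrightarrow> g \<in> U \<Longrightarrow>
      graph_dist (restricted_cayley_edges M (carrier G) S) (M #>\<^bsub>G\<^esub> h) (M #>\<^bsub>G\<^esub> (g \<otimes>\<^bsub>G\<^esub> h)) \<le> enat m"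
      using graph_dist_restricted_words[OF subgroup_self assms(4) order_refl U(2) US] by blast
    \<comment> \<open>The successor makes the Lipschitz constant positive even if \<open>m\<close>
      is 0.\<close>
    have "graph_dist (EG n) x y \<le> enat (Suc m)" if e: "{x, y} \<in> EH n" for n x y
    proof -
      from e[unfolded EH_def] have "graph_dist (EG n) x y \<le> enat m"
      proof (rule restricted_cayley_edgesE)
        fix h u assume "h \<in> K" "u \<in> U"
          "x = N n #>\<^bsub>G\<^esub> h \<and> y = N n #>\<^bsub>G\<^esub> (u \<otimes>\<^bsub>G\<^esub> h) \<or> x = N n #>\<^bsub>G\<^esub> (u \<otimes>\<^bsub>G\<^esub> h) \<and> y = N n #>\<^bsub>G\<^esub> h"
        then show ?thesis
          using m[of h u "N n"] graph_dist_sym[OF m[of h u "N n"]] K.subset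
          unfolding EG_def by auto
      qed
      then show ?thesis
        by (rule graph_dist_mono) simp
    qed
    then show ?thesis
      by (rule graph_seq_precI) simp_all
  qed
  moreover have "graph_seq_prec V EG EH"
  proof -
    \<comment> \<open>These Schreier elements are the middle parts of the detours replacing Cayley
      edges; there are finitely many and \<open>T\<close> generates each.\<close>
    define F where "F = (\<lambda>(r', s, r). inv\<^bsub>G\<^esub> r' \<otimes>\<^bsub>G\<^esub> (s \<otimes>\<^bsub>G\<^esub> r)) ` (R \<times> S \<times> R) \<inter> K"
    have F: "finite F" "F \<subseteq> generate G T"
      using R assms(3) T by (auto simp: F_def)
    obtain m where m: "\<And>M h g. h \<in> K \<Longrightarrow> g \<in> F \<Longrightarrow>
      graph_dist (restricted_cayley_edges M K U) (M #>\<^bsub>G\<^esub> h) (M #>\<^bsub>G\<^esub> (g \<otimes>\<^bsub>G\<^esub> h)) \<le> enat m"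
      using graph_dist_restricted_words[OF K.subgroup_axioms T(1) U(3) F] by blast
    have gen: "graph_dist (EH n) (N n #>\<^bsub>G\<^esub> g) (N n #>\<^bsub>G\<^esub> (s \<otimes>\<^bsub>G\<^esub> g)) \<le> enat (m + 2)"
      if gs: "g \<in> carrier G" "s \<in> S" for n g s
    proof -
      obtain r where r: "r \<in> R" "inv\<^bsub>G\<^esub> r \<otimes>\<^bsub>G\<^esub> g \<in> K"
        using ex[OF gs(1)] by blast
      define h where "h = inv\<^bsub>G\<^esub> r \<otimes>\<^bsub>G\<^esub> g"
      have c: "s \<in> carrier G" "r \<in> carrier G" "h \<in> carrier G" "h \<in> K"
        using r gs R assms(4) K.subset by (auto simp: h_def)
      have g: "g = r \<otimes>\<^bsub>G\<^esub> h"
        using c gs by (simp add: h_def m_assoc[symmetric])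
      obtain r' where r': "r' \<in> R" "inv\<^bsub>G\<^esub> r' \<otimes>\<^bsub>G\<^esub> (s \<otimes>\<^bsub>G\<^esub> r) \<in> K"
        using ex[of "s \<otimes>\<^bsub>G\<^esub> r"] c by auto
      define t where "t = inv\<^bsub>G\<^esub> r' \<otimes>\<^bsub>G\<^esub> (s \<otimes>\<^bsub>G\<^esub> r)"
      have c': "r' \<in> carrier G" "t \<in> carrier G" "t \<in> K"
        using r' R K.subset by (auto simp: t_def)
      have tF: "t \<in> F"
        using r r' gs unfolding F_def t_def
        by (intro IntI image_eqI[of _ _ "(r', s, r)"]) auto
      have sg: "s \<otimes>\<^bsub>G\<^esub> g = r' \<otimes>\<^bsub>G\<^esub> (t \<otimes>\<^bsub>G\<^esub> h)"
        using c c' by (simp add: g t_def m_assoc[symmetric])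
      have "graph_dist (EH n) (N n #>\<^bsub>G\<^esub> g) (N n #>\<^bsub>G\<^esub> h) \<le> enat 1"
        unfolding EH_def g using c r U(4)
        by (intro graph_dist_sym[OF graph_dist_restricted_generator]) auto
      moreover have "graph_dist (EH n) (N n #>\<^bsub>G\<^esub> h) (N n #>\<^bsub>G\<^esub> (t \<otimes>\<^bsub>G\<^esub> h)) \<le> enat m"
        unfolding EH_def using m c tF by blast
      moreover have "graph_dist (EH n) (N n #>\<^bsub>G\<^esub> (t \<otimes>\<^bsub>G\<^esub> h)) (N n #>\<^bsub>G\<^esub> (s \<otimes>\<^bsub>G\<^esub> g)) \<le> enat 1"
        unfolding EH_def sg using c c' r' U(4)
        by (intro graph_dist_restricted_generator) auto
      \<comment> \<open>One edge labelled \<open>r\<close> is taken backwards to \<open>h\<close>,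
        at most \<open>m\<close> edges spell \<open>t\<close>, and one edge labelled
        \<open>r'\<close> leads out again.\<close>
      ultimately have "graph_dist (EH n) (N n #>\<^bsub>G\<^esub> g) (N n #>\<^bsub>G\<^esub> (s \<otimes>\<^bsub>G\<^esub> g)) \<le> enat (1 + (m + 1))"
        by (intro graph_dist_trans)
      then show ?thesis
        by simp
    qed
    have "graph_dist (EH n) x y \<le> enat (m + 2)" if e: "{x, y} \<in> EG n" for n x y
      using e[unfolded EG_def]
    proof (rule restricted_cayley_edgesE)
      fix g s assume "g \<in> carrier G" "s \<in> S"
        "x = N n #>\<^bsub>G\<^esub> g \<and> y = N n #>\<^bsub>G\<^esub> (s \<otimes>\<^bsub>G\<^esub> g) \<or> x = N n #>\<^bsub>G\<^esub> (s \<otimes>\<^bsub>G\<^esub> g) \<and> y = N n #>\<^bsub>G\<^esub> g"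
      then show ?thesis
        using gen[of g s n] graph_dist_sym[OF gen[of g s n]] by auto
    qed
    then show ?thesis
      by (rule graph_seq_precI) simp_all
  qed
  ultimately have "cost V EG \<le> edge_ratio V EH"
    unfolding cost_def graph_seq_equiv_def by (intro INF_lower) simp
  \<comment> \<open>The edge count works for every \<open>n \<ge> k\<close>, when \<open>N n\<close>
    lies in \<open>K\<close>, so even the upper limit is bounded.\<close>
  also have "\<dots> \<le> limsup (\<lambda>n. ereal (real (card (EH n)) / real (card (V n))))"
    unfolding edge_ratio_def by (rule Liminf_le_Limsup) simp
  also have "\<dots> \<le> ereal (real (min_generators G K) / real (card (rcosets\<^bsub>G\<^esub> K)) + 1)"
  proof (rule Limsup_bounded, rule eventually_sequentiallyI)
    fix n assume "k \<le> n"
    then have "N n \<subseteq> K"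
      unfolding K_def using dec by (simp add: decseqD)
    define q where "q = card ((\<lambda>h. N n #>\<^bsub>G\<^esub> h) ` K)"
    have qR: "q * card R \<le> card (V n)"
      unfolding q_def V_def
      using card_rcosets_subgroup_mult_le[OF assms(6) nK \<open>N n \<subseteq> K\<close> assms(7) R(1) un] .
    have "K \<in> rcosets\<^bsub>G\<^esub> K" "finite (rcosets\<^bsub>G\<^esub> K)"
      using K.subgroup_in_rcosets[OF is_group] assms(7) by (auto simp: K_def)
    then have R0: "card R > 0"
      using R(3) card_gt_0_iff by fastforce
    have "N n \<in> rcosets\<^bsub>G\<^esub> N n"
      by (rule subgroup.subgroup_in_rcosets[OF normal_imp_subgroup[OF assms(6)] is_group])
    then have V0: "card (V n) > 0"
      unfolding V_def using assms(7) card_gt_0_iff by fastforce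
    have "card U \<le> card T + card R"
      unfolding U_def by (rule card_Un_le)
    then have "card (EH n) \<le> q * (card T + card R)"
      using card_restricted_cayley_edges_le[OF assms(6) K.subset assms(7) U(1,2)]
      unfolding EH_def q_def by (meson mult_le_mono2 order_trans)
    \<comment> \<open>Multiplying by \<open>card R\<close> produces the factor
      \<open>q * card R\<close>, which the coset count bounds by the number of vertices.\<close>
    then have "card (EH n) * card R \<le> q * (card T + card R) * card R"
      by simp
    also have "\<dots> = (q * card R) * (card T + card R)"
      by (simp add: ac_simps)
    also have "\<dots> \<le> card (V n) * (card T + card R)"
      using qR by simp
    finally have "real (card (EH n)) * real (card R) \<le> real (card (V n)) * (real (card T) + real (card R))"
      by (metis of_nat_add of_nat_le_iff of_nat_mult)
    then have "real (card (EH n)) / real (card (V n)) \<le> real (card T) / real (card R) + 1"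
      using R0 V0 by (simp add: field_simps)
    then show "ereal (real (card (EH n)) / real (card (V n)))
        \<le> ereal (real (min_generators G K) / real (card (rcosets\<^bsub>G\<^esub> K)) + 1)"
      using T(3) R(3) by simp
  qed
  finally show ?thesis
    unfolding EG V_def K_def .
qed

end
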